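(* Let $X$ be an abelian surface over a field, $H$ an ample divisor on $X$, $\beta\in \mathrm{NS}(X)_{\mathbb R}$. Let $v$ be a Mukai vector of rank $r$ and $v_2$ a Mukai vector of rank $r_2$, written as $$v=re^\beta+(d_\beta H+D_\beta)+(d_\beta H+D_\beta,\beta)\varrho_X+a_\beta\varrho_X,\qquad v_2=r_2e^\beta+(d_2H+D_2)+(d_2H+D_2,\beta)\varrho_X+a_2\varrho_X$$ with $d_\beta,a_\beta,d_2,a_2\in\mathbb R$ and $D_\beta,D_2\in H^\perp\subset\mathrm{NS}(X)_{\mathbb R}$. Assume $r\neq0$ and $\langle v^2\rangle>0$. (1) Assume $rd_2-r_2d_\beta\ne0$. Then $\mathbb R Z_{(\beta+sH,tH)}(v)=\mathbb R Z_{(\beta+sH,tH)}(v_2)$ holds for $(s,t)\in\mathbb R^2$, $t>0$, if and only if $$t^2+\left(s-\frac{a_2r-a_\beta r_2}{(H^2)(rd_2-r_2d_\beta)}\right)^2=\left(\frac{d_\beta}{r}-\frac{a_2r-a_\beta r_2}{(H^2)(rd_2-r_2d_\beta)}\right)^2-\frac{\langle v^2\rangle-(D_\beta^2)}{(H^2)r^2}.$$ (2) Assume $rd_2-r_2d_\beta=0$ and $a_2r-a_\beta r_2\ne0$. Then $\mathbb R Z_{(\beta+sH,tH)}(v)=\mathbb R Z_{(\beta+sH,tH)}(v_2)$ holds for $(s,t)\in\mathbb R^2$, $t>0$, if and only if $rs-d_\beta=0$.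
   Context: $H^*(X,\mathbb Z)_{\mathrm{alg}}=\mathbb Z\oplus \mathrm{NS}(X)\oplus\mathbb Z\varrho_X$ ($\varrho_X$ the fundamental class, i.e. the class of a point) carries the Mukai pairing $\langle x,y\rangle=(x_1,y_1)-(x_0y_2+x_2y_0)$; its elements are called Mukai vectors and the rank of $x$ is $x_0$. $e^\beta=1+\beta+\frac{(\beta^2)}2\varrho_X$. The stability function is $Z_{(\beta,\omega)}(v)=\langle e^{\beta+\sqrt{-1}\omega},v\rangle$ (pairing extended $\mathbb C$-linearly), and $\mathbb RZ$ denotes the real span of the complex number $Z$.
   Formalization: In both (1) and (2) the right-hand side of the equivalence also requires Z_{(β+sH,tH)}(v_2) ≠ 0; without this the "if" direction fails, e.g. (H²)=2, β=0, v=(1,H,0), v_2=(1,0,1), (s,t)=(0,1). *)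

theory Defs
  imports "HOL-Analysis.Analysis"
begin

(* NS(X) of an abelian surface is free of finite rank, so after the choice of a Z-basis it is
   int ^ 'n, with NS(X)_R = real ^ 'n and NS(X)_C = complex ^ 'n.  Q is the Gram matrix of the
   intersection form; the pairings below are the bilinear extensions to a coefficient ring 'k. *)

definition ip :: "int ^ 'n ^ 'n \<Rightarrow> 'k::comm_ring_1 ^ 'n \<Rightarrow> 'k ^ 'n \<Rightarrow> 'k" where
  "ip Q x y = (\<Sum>i\<in>UNIV. \<Sum>j\<in>UNIV. of_int (Q $ i $ j) * x $ i * y $ j)"

(* The numerical data of an abelian surface over a field: its intersection form and the set of
   ample classes.  even_form is Riemann-Roch, chi(L) = (L^2)/2; hodge_index is the Hodge index
   theorem; ample_iff is the description of the ample cone of an abelian surface as the component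
   of the positive cone that contains one given ample class; ample_nonempty is projectivity. *)

locale abelian_surface_NS =
  fixes Q :: "int ^ 'n ^ 'n"
    and ample :: "(int ^ 'n) set"
  assumes symmetric_form: "Q $ i $ j = Q $ j $ i"
    and even_form: "\<And>x :: int ^ 'n. even (ip Q x x)"
    and hodge_index: "\<And>h x :: real ^ 'n.
      ip Q h h > 0 \<Longrightarrow> ip Q h x = 0 \<Longrightarrow> x \<noteq> 0 \<Longrightarrow> ip Q x x < 0"
    and ample_nonempty: "ample \<noteq> {}"
    and ample_iff: "h \<in> ample \<Longrightarrow> x \<in> ample \<longleftrightarrow> ip Q x x > 0 \<and> ip Q h x > 0"

(* A triple (x0, x1, x2) stands for x0 + x1 + x2 rho_X in H^*(X,Z)_alg with coefficients extended
   to 'k; a Mukai vector is one with 'k = int. *)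

type_synonym ('k, 'n) mukai = "'k \<times> ('k ^ 'n) \<times> 'k"

definition rk :: "('k, 'n) mukai \<Rightarrow> 'k" where
  "rk x = fst x"

definition NS_incl :: "'k::zero ^ 'n \<Rightarrow> ('k, 'n) mukai" where
  "NS_incl x = (0, x, 0)"

definition pt_class :: "('k::zero_neq_one, 'n::finite) mukai" where
  "pt_class = (0, 0, 1)"

definition mukai_pairing ::
    "int ^ 'n ^ 'n \<Rightarrow> ('k::comm_ring_1, 'n) mukai \<Rightarrow> ('k, 'n) mukai \<Rightarrow> 'k" where
  "mukai_pairing Q = (\<lambda>(x0, x1, x2) (y0, y1, y2). ip Q x1 y1 - (x0 * y2 + x2 * y0))"

definition exp_class :: "int ^ 'n ^ 'n \<Rightarrow> 'k::field ^ 'n \<Rightarrow> ('k, 'n) mukai" where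
  "exp_class Q \<beta> = (1, \<beta>, ip Q \<beta> \<beta> / 2)"

definition NS_ext :: "int ^ 'n \<Rightarrow> 'k::ring_1 ^ 'n" where
  "NS_ext x = (\<chi> i. of_int (x $ i))"

definition mukai_ext :: "(int, 'n::finite) mukai \<Rightarrow> ('k::ring_1, 'n) mukai" where
  "mukai_ext = (\<lambda>(x0, x1, x2). (of_int x0, NS_ext x1, of_int x2))"

definition NS_complex :: "real ^ 'n \<Rightarrow> real ^ 'n \<Rightarrow> complex ^ 'n" where
  "NS_complex \<beta> \<omega> = (\<chi> i. of_real (\<beta> $ i) + \<i> * of_real (\<omega> $ i))"

definition stab_Z ::
    "int ^ 'n ^ 'n \<Rightarrow> real ^ 'n \<Rightarrow> real ^ 'n \<Rightarrow> (int, 'n) mukai \<Rightarrow> complex" where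
  "stab_Z Q \<beta> \<omega> v = mukai_pairing Q (exp_class Q (NS_complex \<beta> \<omega>)) (mukai_ext v)"

(* The vector r e^beta + (d H + D) + (d H + D, beta) rho_X + a rho_X. *)

definition mukai_expansion ::
    "int ^ 'n ^ 'n \<Rightarrow> real ^ 'n \<Rightarrow> real ^ 'n \<Rightarrow> real \<Rightarrow> real \<Rightarrow> real ^ 'n \<Rightarrow> real \<Rightarrow> (real, 'n) mukai" where
  "mukai_expansion Q \<beta> H r d D a =
     r *\<^sub>R exp_class Q \<beta> + NS_incl (d *\<^sub>R H + D)
       + ip Q (d *\<^sub>R H + D) \<beta> *\<^sub>R pt_class + a *\<^sub>R pt_class"

end

theory Submission
  imports Defs
begin

(* Write c = s + i t.  All terms involving beta cancel in Z, which leaves the quadratic polynomial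
   Z(v) = c d (H^2) - a - r c^2 (H^2) / 2, and similarly <v^2> = d^2 (H^2) + (D^2) - 2 r a.
   By the Hodge index theorem <v^2> > 0 forces Z(v) to be nonzero, so the real lines agree iff
   Z(v2) is nonzero and Re Z(v) Im Z(v2) = Im Z(v) Re Z(v2).  The difference of the two sides is
   t (H^2) times
     (H^2) (r d2 - r2 d) (s^2 + t^2) / 2 - (a2 r - a r2) s + (a2 d - a d2). *)

lemma ip_add_left: "ip Q (x + y) z = ip Q x z + ip Q y z"
  by (simp add: ip_def algebra_simps sum.distrib)

lemma ip_add_right: "ip Q z (x + y) = ip Q z x + ip Q z y"
  by (simp add: ip_def algebra_simps sum.distrib)

lemma ip_vscale_left: "ip Q (c *s x) y = c * ip Q x y"
  by (simp add: ip_def sum_distrib_left algebra_simps)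

lemma ip_vscale_right: "ip Q x (c *s y) = c * ip Q x y"
  by (simp add: ip_def sum_distrib_left algebra_simps)

lemma ip_scaleR_left: "ip Q (c *\<^sub>R x) y = c * ip Q x y" for x y :: "real ^ 'n"
  by (simp flip: scalar_mult_eq_scaleR add: ip_vscale_left)

lemma ip_scaleR_right: "ip Q x (c *\<^sub>R y) = c * ip Q x y" for x y :: "real ^ 'n"
  by (simp flip: scalar_mult_eq_scaleR add: ip_vscale_right)

lemmas ip_bilinear = ip_add_left ip_add_right ip_vscale_left ip_vscale_right
  ip_scaleR_left ip_scaleR_right

lemma ip_commute:
  assumes "\<And>i j. Q $ i $ j = Q $ j $ i"
  shows "ip Q x y = ip Q y x"
  unfolding ip_def by (subst sum.swap) (simp add: assms mult_ac)

lemma ip_NS_ext: "ip Q (NS_ext x) (NS_ext y) = of_int (ip Q x y)"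
  by (simp add: ip_def NS_ext_def)

lemma mukai_pairing_ext:
  "mukai_pairing Q (mukai_ext x) (mukai_ext y) = of_int (mukai_pairing Q x y)"
  by (simp add: mukai_pairing_def mukai_ext_def ip_NS_ext split: prod.split)

definition complexify :: "real ^ 'n \<Rightarrow> complex ^ 'n" where
  "complexify x = (\<chi> i. of_real (x $ i))"

lemma ip_complexify: "ip Q (complexify x) (complexify y) = of_real (ip Q x y)"
  by (simp add: ip_def complexify_def)

text \<open>The two occurrences of \<open>NS_ext\<close> differ in type: complex on the left, real
  on the right. This carries the real expansion of a Mukai vector over to the complex pairing in
  \<open>stab_Z\<close>.\<close>

lemma NS_ext_complexify: "NS_ext x = complexify (NS_ext x)"
  by (simp add: complexify_def NS_ext_def)

lemma NS_complex_shift: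
  "NS_complex (\<beta> + s *\<^sub>R H) (t *\<^sub>R H) = complexify \<beta> + Complex s t *s complexify H"
  by (simp add: vec_eq_iff NS_complex_def complexify_def complex_eq_iff)

lemma mukai_expansion_eq:
  "mukai_expansion Q \<beta> H r d D a =
    (r, r *\<^sub>R \<beta> + d *\<^sub>R H + D, r * ip Q \<beta> \<beta> / 2 + ip Q (d *\<^sub>R H + D) \<beta> + a)"
  by (simp add: mukai_expansion_def exp_class_def NS_incl_def pt_class_def)

text \<open>The vectors xi + (xi, \<beta>) rho_X are orthogonal to both e^\<beta> and rho_X, and
  these two span a hyperbolic plane: both are isotropic and their pairing is -1. Since H and D are
  orthogonal, only three terms survive.\<close>

lemma mukai_square_expansion:
  assumes "\<And>i j. Q $ i $ j = Q $ j $ i" and "ip Q H D = 0"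
  shows "mukai_pairing Q (mukai_expansion Q \<beta> H r d D a) (mukai_expansion Q \<beta> H r d D a) =
    d\<^sup>2 * ip Q H H + ip Q D D - 2 * r * a"
  using assms(2) ip_commute[OF assms(1), of D H] ip_commute[OF assms(1), of \<beta> H]
    ip_commute[OF assms(1), of \<beta> D]
  by (simp add: mukai_pairing_def mukai_expansion_eq ip_bilinear algebra_simps power2_eq_square)

text \<open>With c = s + i t, the class e^(\<beta> + c H) has itself an expansion of the same shape,
  with coefficients 1, c, c^2 (H^2) / 2 and no part in the complement of H. Pairing it with v
  therefore kills D; the right-hand side lists the real and imaginary parts.\<close>

lemma stab_Z_expansion:
  assumes sym: "\<And>i j. Q $ i $ j = Q $ j $ i" and perp: "ip Q H D = 0"
    and v: "mukai_ext v = mukai_expansion Q \<beta> H r d D a"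
  shows "stab_Z Q (\<beta> + s *\<^sub>R H) (t *\<^sub>R H) v =
    Complex (d * ip Q H H * s - a - r * ip Q H H * (s\<^sup>2 - t\<^sup>2) / 2)
            (t * ip Q H H * (d - r * s))"
proof -
  obtain v0 v1 v2 where vv: "v = (v0, v1, v2)" by (cases v)
  define x where "x = r *\<^sub>R \<beta> + d *\<^sub>R H + D"
  define b where "b = r * ip Q \<beta> \<beta> / 2 + ip Q (d *\<^sub>R H + D) \<beta> + a"
  have comps: "real_of_int v0 = r" "NS_ext v1 = x" "real_of_int v2 = b"
    using v by (simp_all add: vv mukai_ext_def mukai_expansion_eq x_def b_def)
  \<comment> \<open>The outer components are known only as reals; they pass to the complex numbers
    through the underlying integers.\<close>
  have "(of_int v0 :: complex) = of_real r" "(of_int v2 :: complex) = of_real b"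
    by (simp_all flip: comps)
  then have ext: "mukai_ext v = (of_real r :: complex, complexify x, of_real b)"
    using NS_ext_complexify[of v1] by (simp add: vv mukai_ext_def comps)
  have "ip Q H x = r * ip Q \<beta> H + d * ip Q H H"
    "ip Q \<beta> x = r * ip Q \<beta> \<beta> + d * ip Q \<beta> H + ip Q \<beta> D"
    "b = r * ip Q \<beta> \<beta> / 2 + d * ip Q \<beta> H + ip Q \<beta> D + a"
    using perp ip_commute[OF sym, of H \<beta>] ip_commute[OF sym, of D \<beta>]
    by (simp_all add: x_def b_def ip_bilinear)
  then show ?thesis
    using ip_commute[OF sym, of H \<beta>]
    by (simp add: stab_Z_def ext mukai_pairing_def exp_class_def NS_complex_shift ip_bilinear
        ip_complexify complex_eq_iff power2_eq_square field_simps)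
qed

text \<open>Turns equality of real lines into a polynomial equation, the vanishing of Im (cnj z *
  w). That equation also holds for w = 0, where the span is only a point, so
  \<open>w \<noteq> 0\<close> is a separate condition.\<close>

lemma span_singleton_complex_eq_iff:
  fixes z w :: complex
  assumes "z \<noteq> 0"
  shows "span {z} = span {w} \<longleftrightarrow> w \<noteq> 0 \<and> Re z * Im w = Im z * Re w"
proof
  assume eq: "span {z} = span {w}"
  have "z \<in> span {w}" by (simp flip: eq add: span_base)
  then obtain k where "z = k *\<^sub>R w" by (auto simp: span_singleton)
  with assms show "w \<noteq> 0 \<and> Re z * Im w = Im z * Re w" by auto
next
  assume w: "w \<noteq> 0 \<and> Re z * Im w = Im z * Re w"
  \<comment> \<open>\<open>k\<close> is the coefficient of the orthogonal projection of
    \<open>z\<close> onto the line of \<open>w\<close>; the error of the projection is a multiple of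
    the determinant assumed to vanish.\<close>
  define k where "k = (Re z * Re w + Im z * Im w) / (norm w)\<^sup>2"
  have nz: "(norm w)\<^sup>2 \<noteq> 0" using w by simp
  have "Re z * (norm w)\<^sup>2 - (Re z * Re w + Im z * Im w) * Re w
      = Im w * (Re z * Im w - Im z * Re w)"
    and "Im z * (norm w)\<^sup>2 - (Re z * Re w + Im z * Im w) * Im w
      = - Re w * (Re z * Im w - Im z * Re w)"
    unfolding cmod_power2 by (simp_all add: power2_eq_square algebra_simps)
  then have z: "z = k *\<^sub>R w"
    using nz w unfolding k_def complex_eq_iff by (simp add: nonzero_eq_divide_eq)
  with assms have "k \<noteq> 0" by auto
  then show "span {z} = span {w}" using span_image_scale[of "{w}" "\<lambda>_. k"] z by simp
qed


(* span is the real span, so span {z} is the set RZ of real multiples of z.  The conjunct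
   stab_Z ... v2 \<noteq> 0 cannot be dropped: the right-hand equations can hold at a point where
   Z(v2) = 0, and there RZ(v2) = 0 while RZ(v) is a line. *)
theorem proposition5p5:
  fixes Q :: "int ^ 'n ^ 'n"
    and ample :: "(int ^ 'n) set"
    and H :: "int ^ 'n"
    and HR \<beta> D\<^sub>\<beta> D2 :: "real ^ 'n"
    and v v2 :: "(int, 'n) mukai"
    and r r2 d\<^sub>\<beta> d2 a\<^sub>\<beta> a2 h :: real
  assumes X: "abelian_surface_NS Q ample"
    and H: "H \<in> ample"
    and HR: "HR = NS_ext H"
    and h: "h = ip Q HR HR"
    and r: "r = of_int (rk v)"
    and r2: "r2 = of_int (rk v2)"
    and D_perp: "ip Q HR D\<^sub>\<beta> = 0"
    and D2_perp: "ip Q HR D2 = 0"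
    and v: "mukai_ext v = mukai_expansion Q \<beta> HR r d\<^sub>\<beta> D\<^sub>\<beta> a\<^sub>\<beta>"
    and v2: "mukai_ext v2 = mukai_expansion Q \<beta> HR r2 d2 D2 a2"
    and r_nz: "r \<noteq> 0"
    and v_pos: "mukai_pairing Q v v > 0"
  shows
    "(r * d2 - r2 * d\<^sub>\<beta> \<noteq> 0 \<longrightarrow>
       (\<forall>s t. t > 0 \<longrightarrow>
         (span {stab_Z Q (\<beta> + s *\<^sub>R HR) (t *\<^sub>R HR) v}
            = span {stab_Z Q (\<beta> + s *\<^sub>R HR) (t *\<^sub>R HR) v2}
          \<longleftrightarrow>
          stab_Z Q (\<beta> + s *\<^sub>R HR) (t *\<^sub>R HR) v2 \<noteq> 0 \<and>
          t\<^sup>2 + (s - (a2 * r - a\<^sub>\<beta> * r2) / (h * (r * d2 - r2 * d\<^sub>\<beta>)))\<^sup>2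
            = (d\<^sub>\<beta> / r - (a2 * r - a\<^sub>\<beta> * r2) / (h * (r * d2 - r2 * d\<^sub>\<beta>)))\<^sup>2
              - (of_int (mukai_pairing Q v v) - ip Q D\<^sub>\<beta> D\<^sub>\<beta>) / (h * r\<^sup>2))))
     \<and>
     (r * d2 - r2 * d\<^sub>\<beta> = 0 \<and> a2 * r - a\<^sub>\<beta> * r2 \<noteq> 0 \<longrightarrow>
       (\<forall>s t. t > 0 \<longrightarrow>
         (span {stab_Z Q (\<beta> + s *\<^sub>R HR) (t *\<^sub>R HR) v}
            = span {stab_Z Q (\<beta> + s *\<^sub>R HR) (t *\<^sub>R HR) v2}
          \<longleftrightarrow>
          stab_Z Q (\<beta> + s *\<^sub>R HR) (t *\<^sub>R HR) v2 \<noteq> 0 \<and>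
          r * s - d\<^sub>\<beta> = 0)))"
proof -
  interpret abelian_surface_NS Q ample by (fact X)
  have h_pos: "h > 0"
  proof -
    have "ip Q H H > 0" using ample_iff[OF H, of H] H by blast
    then show ?thesis by (simp add: h HR ip_NS_ext)
  qed
  define N where "N = of_int (mukai_pairing Q v v) - ip Q D\<^sub>\<beta> D\<^sub>\<beta>"
  have N: "N = d\<^sub>\<beta>\<^sup>2 * h - 2 * r * a\<^sub>\<beta>"
    using mukai_square_expansion[OF symmetric_form D_perp, of \<beta> r d\<^sub>\<beta> a\<^sub>\<beta>]
    unfolding N_def h by (simp flip: v add: mukai_pairing_ext)
  have "ip Q D\<^sub>\<beta> D\<^sub>\<beta> \<le> 0"
  proof (cases "D\<^sub>\<beta> = 0")
    case True
    then show ?thesis by (simp add: ip_def)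
  next
    case False
    then show ?thesis using hodge_index[of HR "D\<^sub>\<beta>"] h_pos D_perp by (simp add: h)
  qed
  moreover have "real_of_int (mukai_pairing Q v v) > 0" using v_pos by simp
  ultimately have N_pos: "N > 0" unfolding N_def by linarith
  note Z = stab_Z_expansion[OF symmetric_form D_perp v, folded h]
    and Z2 = stab_Z_expansion[OF symmetric_form D2_perp v2, folded h]
  \<comment> \<open>\<delta> and \<epsilon> are two of the 2x2 minors of the matrix with rows (r, d,
    a) and (r2, d2, a2); the third is the constant term of the quadratic below.\<close>
  define \<delta> where "\<delta> = r * d2 - r2 * d\<^sub>\<beta>"
  define \<epsilon> where "\<epsilon> = a2 * r - a\<^sub>\<beta> * r2"
  have lines_agree_iff:
    "span {stab_Z Q (\<beta> + s *\<^sub>R HR) (t *\<^sub>R HR) v} = span {stab_Z Q (\<beta> + s *\<^sub>R HR) (t *\<^sub>R HR) v2}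
      \<longleftrightarrow> stab_Z Q (\<beta> + s *\<^sub>R HR) (t *\<^sub>R HR) v2 \<noteq> 0 \<and>
        h * \<delta> * (s\<^sup>2 + t\<^sup>2) / 2 - \<epsilon> * s + (a2 * d\<^sub>\<beta> - a\<^sub>\<beta> * d2) = 0"
    if t: "t > 0" for s t
  proof -
    have nz: "stab_Z Q (\<beta> + s *\<^sub>R HR) (t *\<^sub>R HR) v \<noteq> 0"
    proof
      assume "stab_Z Q (\<beta> + s *\<^sub>R HR) (t *\<^sub>R HR) v = 0"
      then have re: "d\<^sub>\<beta> * h * s - a\<^sub>\<beta> - r * h * (s\<^sup>2 - t\<^sup>2) / 2 = 0" and d: "d\<^sub>\<beta> = r * s"
        using t h_pos by (auto simp: Z complex_eq_iff)
      \<comment> \<open>Where the imaginary part vanishes, the factor 2 r completes the real part to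
        a sum of \<open>N > 0\<close> and a nonnegative term, whatever the sign of r.\<close>
      have "2 * r * (d\<^sub>\<beta> * h * s - a\<^sub>\<beta> - r * h * (s\<^sup>2 - t\<^sup>2) / 2) = N + r\<^sup>2 * h * t\<^sup>2"
        by (simp add: N d field_simps power2_eq_square)
      moreover have "r\<^sup>2 * h * t\<^sup>2 \<ge> 0" using h_pos by simp
      ultimately show False using re N_pos by simp
    qed
    let ?x = "d\<^sub>\<beta> * h * s - a\<^sub>\<beta> - r * h * (s\<^sup>2 - t\<^sup>2) / 2" and ?y = "t * h * (d\<^sub>\<beta> - r * s)"
    let ?x2 = "d2 * h * s - a2 - r2 * h * (s\<^sup>2 - t\<^sup>2) / 2" and ?y2 = "t * h * (d2 - r2 * s)"
    let ?E = "h * \<delta> * (s\<^sup>2 + t\<^sup>2) / 2 - \<epsilon> * s + (a2 * d\<^sub>\<beta> - a\<^sub>\<beta> * d2)"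
    have "?x * ?y2 = ?y * ?x2 \<longleftrightarrow> ?x * ?y2 - ?y * ?x2 = 0" by (rule eq_iff_diff_eq_0)
    also have "?x * ?y2 - ?y * ?x2 = t * h * ?E"
      by (simp add: \<delta>_def \<epsilon>_def field_simps power2_eq_square)
    also have "t * h * ?E = 0 \<longleftrightarrow> ?E = 0"
      using t h_pos by simp
    finally show ?thesis
      by (simp only: span_singleton_complex_eq_iff[OF nz]) (simp only: Z Z2 complex.sel)
  qed
  have circle_iff: "h * \<delta> * (s\<^sup>2 + t\<^sup>2) / 2 - \<epsilon> * s + (a2 * d\<^sub>\<beta> - a\<^sub>\<beta> * d2) = 0 \<longleftrightarrow>
      t\<^sup>2 + (s - \<epsilon> / (h * \<delta>))\<^sup>2 = (d\<^sub>\<beta> / r - \<epsilon> / (h * \<delta>))\<^sup>2 - N / (h * r\<^sup>2)"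
    if \<delta>: "\<delta> \<noteq> 0" for s t
  proof -
    define e where "e = \<epsilon> / (h * \<delta>)"
    have e: "\<epsilon> = e * (h * \<delta>)" using \<delta> h_pos by (simp add: e_def)
    define A where "A = a\<^sub>\<beta> / r"
    define d where "d = d\<^sub>\<beta> / r"
    have Ad: "a\<^sub>\<beta> = A * r" "d\<^sub>\<beta> = d * r" using r_nz by (simp_all add: A_def d_def)
    have N': "N / (h * r\<^sup>2) = d\<^sup>2 - 2 * A / h"
      using r_nz h_pos by (simp add: N Ad field_simps power2_eq_square)
    \<comment> \<open>The three minors satisfy one linear relation: the 3x3 determinant with the row
      (r, d, a) repeated is zero. Here it is divided by r.\<close>
    have const: "a2 * d\<^sub>\<beta> - a\<^sub>\<beta> * d2 = d * \<epsilon> - A * \<delta>"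
      by (simp add: \<delta>_def \<epsilon>_def Ad algebra_simps)
    \<comment> \<open>Completing the square in s, with centre \<open>e\<close>; the leading factor
      is nonzero.\<close>
    have eq: "h * \<delta> * (s\<^sup>2 + t\<^sup>2) / 2 - \<epsilon> * s + (a2 * d\<^sub>\<beta> - a\<^sub>\<beta> * d2) =
        h * \<delta> / 2 * (t\<^sup>2 + (s - e)\<^sup>2 - ((d - e)\<^sup>2 - (d\<^sup>2 - 2 * A / h)))"
      unfolding const e using h_pos by (simp add: field_simps power2_eq_square)
    show ?thesis using \<delta> h_pos unfolding eq by (simp add: N' flip: e_def d_def)
  qed
  have line_iff: "h * \<delta> * (s\<^sup>2 + t\<^sup>2) / 2 - \<epsilon> * s + (a2 * d\<^sub>\<beta> - a\<^sub>\<beta> * d2) = 0 \<longleftrightarrow>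
      r * s - d\<^sub>\<beta> = 0"
    if \<delta>: "\<delta> = 0" and \<epsilon>: "\<epsilon> \<noteq> 0" for s t
  proof -
    \<comment> \<open>The same relation between the minors; with \<delta> = 0 the quadratic terms
      vanish and a linear form in s is left, independent of t.\<close>
    have "r * (a2 * d\<^sub>\<beta> - a\<^sub>\<beta> * d2) = \<epsilon> * d\<^sub>\<beta> - a\<^sub>\<beta> * \<delta>"
      by (simp add: \<delta>_def \<epsilon>_def algebra_simps)
    then have "r * (h * \<delta> * (s\<^sup>2 + t\<^sup>2) / 2 - \<epsilon> * s + (a2 * d\<^sub>\<beta> - a\<^sub>\<beta> * d2)) = - \<epsilon> * (r * s - d\<^sub>\<beta>)"
      using \<delta> by (simp add: algebra_simps)
    then show ?thesis using \<epsilon> r_nz by (metis mult_eq_0_iff neg_equal_0_iff_equal)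
  qed
  show ?thesis
    using lines_agree_iff circle_iff line_iff unfolding \<delta>_def \<epsilon>_def N_def by auto
qed

end
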